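(* Suppose that for some $\rho>1$, $f:[0,1]\to\mathbb{R}$ extends analytically to $\mathcal{E}_\rho':=\frac12(\mathcal{E}_\rho+1)$, and that there exists $B\ge 0$ such that $|f|\le B$ on $\mathcal{E}_\rho'$. Let $m\ge1$ be an integer and let $$\rho_m:=\max\left[\rho,\ 2^m\frac{(\rho-1)^2}{\rho}\right].$$ Then for every integer $N\ge 1$, $$E_{m,N}[f]\le\frac{4B\rho_m^{-N}}{\rho_m-1}.$$ If $T$ is the quantized tensor representation of $f$ on $\mathcal{D}_K$ for some integer $K>m$, then it follows that, for every $\varepsilon>0$, $$r_m^{(\varepsilon,\infty)}[T]\le 1+\max\left\{1,\ \left\lceil\log_{\rho_m}(1/\varepsilon)-\log_{\rho_m}(\rho_m-1)+\log_{\rho_m}(4B)\right\rceil\right\}.$$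
   Context: Bernstein ellipse: for $\rho>1$, $\mathcal{E}_\rho=\left\{z\in\mathbb{C}:\left[\frac{\mathrm{Re}(z)}{a_\rho}\right]^2+\left[\frac{\mathrm{Im}(z)}{b_\rho}\right]^2\le 1\right\}$ with $a_\rho=\frac{\rho+\rho^{-1}}{2}$, $b_\rho=\frac{\rho-\rho^{-1}}{2}$; $\frac12(\mathcal{E}_\rho+1)=\{(z+1)/2: z\in\mathcal{E}_\rho\}$. When $B=0$, $\log_{\rho_m}(4B)$ is read as $-\infty$. Dyadic grid: $\mathcal{D}_K=(2^{-K}\mathbb{Z})\cap[0,1)$; each $x\in\mathcal{D}_K$ is written uniquely as $x=\sum_{k=1}^K 2^{-k}\sigma_k$ with $\sigma_k\in\{0,1\}$. The quantized tensor representation of $f:[0,1]\to\mathbb{R}$ on $\mathcal{D}_K$ is the tensor $T:\{0,1\}^K\to\mathbb{R}$, $T(\sigma_1,\dots,\sigma_K)=f\left(\sum_{k=1}^K 2^{-k}\sigma_k\right)$. Tensor norm: $\|S\|_\infty=\max_{\sigma\in\{0,1\}^K}|S(\sigma)|$. The $(\varepsilon,\infty)$ rank of the $m$-th unfolding matrix, denoted $r_m^{(\varepsilon,\infty)}[T]$, is the smallest $r$ such that $\left\|T-\sum_{\alpha=0}^{r-1}T_L^\alpha\otimes T_R^\alpha\right\|_\infty\le\varepsilon$ for some tensors $T_L^\alpha:\{0,1\}^m\to\mathbb{R}$ and $T_R^\alpha:\{0,1\}^{K-m}\to\mathbb{R}$, where $(T_L\otimes T_R)(\sigma_1,\dots,\sigma_K)=T_L(\sigma_1,\dots,\sigma_m)\,T_R(\sigma_{m+1},\dots,\sigma_K)$.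 Chebyshev-Lobatto grid on $[0,1]$: $c_N^\alpha=\frac{\cos(\pi\alpha/N)+1}{2}$, $\alpha=0,\dots,N$; $P_N^\alpha$ is the Lagrange basis polynomial of degree $N$ with $P_N^\alpha(c_N^\beta)=\delta^{\alpha\beta}$. Interpolation error: $E_{m,N}[f]=\max_{u\in[0,1-2^{-m}],\,v\in[0,1]}\left|f(u+2^{-m}v)-\sum_{\alpha=0}^N f(u+2^{-m}c_N^\alpha)P_N^\alpha(v)\right|$. *)

theory Defs
  imports "HOL-Complex_Analysis.Complex_Analysis" "HOL-Computational_Algebra.Polynomial"
begin

definition bernstein_ellipse :: "real \<Rightarrow> complex set" where
  "bernstein_ellipse \<rho> =
     {z. (Re z / ((\<rho> + inverse \<rho>) / 2))\<^sup>2 + (Im z / ((\<rho> - inverse \<rho>) / 2))\<^sup>2 \<le> 1}"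

definition unit_bernstein_ellipse :: "real \<Rightarrow> complex set" where
  "unit_bernstein_ellipse \<rho> = (\<lambda>z. (z + 1) / 2) ` bernstein_ellipse \<rho>"

definition rho_level :: "real \<Rightarrow> nat \<Rightarrow> real" where
  "rho_level \<rho> m = max \<rho> (2 ^ m * ((\<rho> - 1)\<^sup>2 / \<rho>))"

definition cheb_node :: "nat \<Rightarrow> nat \<Rightarrow> real" where
  "cheb_node N \<alpha> = (cos (pi * real \<alpha> / real N) + 1) / 2"

definition lagrange_basis :: "nat \<Rightarrow> nat \<Rightarrow> real poly" where
  "lagrange_basis N \<alpha> =
     (\<Prod>\<beta>\<in>{..N} - {\<alpha>}.
        smult (1 / (cheb_node N \<alpha> - cheb_node N \<beta>)) [:- cheb_node N \<beta>, 1:])"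

lemma cheb_node_inj:
  assumes "\<alpha> \<le> N" "\<beta> \<le> N" "cheb_node N \<alpha> = cheb_node N \<beta>"
  shows "\<alpha> = \<beta>"
proof (cases "N = 0")
  case True
  then show ?thesis using assms by simp
next
  case False
  have le: "0 \<le> pi * real k / real N" "pi * real k / real N \<le> pi" if "k \<le> N" for k
    using that False by (auto simp: field_simps)
  have "pi * real \<alpha> / real N = pi * real \<beta> / real N"
    by (rule cos_inj_pi) (use le assms in \<open>auto simp: cheb_node_def\<close>)
  then show ?thesis using False by simp
qed

lemma poly_lagrange_basis_node:
  assumes "\<alpha> \<le> N" "\<beta> \<le> N"
  shows "poly (lagrange_basis N \<alpha>) (cheb_node N \<beta>) = (if \<alpha> = \<beta> then 1 else 0)"
proof (cases "\<alpha> = \<beta>")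
  case True
  have "cheb_node N \<alpha> - cheb_node N \<gamma> \<noteq> 0" if "\<gamma> \<in> {..N} - {\<alpha>}" for \<gamma>
    using that assms cheb_node_inj[of \<alpha> N \<gamma>] by auto
  then have "poly (lagrange_basis N \<alpha>) (cheb_node N \<beta>) = (\<Prod>\<gamma>\<in>{..N} - {\<alpha>}. 1)"
    unfolding lagrange_basis_def poly_prod using True
    by (intro prod.cong refl) (simp flip: diff_divide_distrib)
  then show ?thesis using True by simp
next
  case False
  then have "\<beta> \<in> {..N} - {\<alpha>}" using assms by auto
  then show ?thesis
    unfolding lagrange_basis_def poly_prod using False by (auto intro!: bexI[of _ \<beta>])
qed

lemma degree_lagrange_basis:
  assumes "\<alpha> \<le> N"
  shows "degree (lagrange_basis N \<alpha>) = N"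
proof -
  have ne: "cheb_node N \<alpha> - cheb_node N \<gamma> \<noteq> 0" if "\<gamma> \<in> {..N} - {\<alpha>}" for \<gamma>
    using that assms cheb_node_inj[of \<alpha> N \<gamma>] by auto
  have "degree (lagrange_basis N \<alpha>) = (\<Sum>\<gamma>\<in>{..N} - {\<alpha>}.
      degree (smult (1 / (cheb_node N \<alpha> - cheb_node N \<gamma>)) [:- cheb_node N \<gamma>, 1:]))"
    unfolding lagrange_basis_def by (rule degree_prod_eq_sum_degree) (use ne in auto)
  also have "\<dots> = (\<Sum>\<gamma>\<in>{..N} - {\<alpha>}. 1)"
    by (intro sum.cong refl) (use ne in auto)
  finally show ?thesis using assms by simp
qed

definition interp_residual :: "nat \<Rightarrow> nat \<Rightarrow> (real \<Rightarrow> real) \<Rightarrow> real \<Rightarrow> real \<Rightarrow> real" where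
  "interp_residual m N f u v =
     \<bar>f (u + v / 2 ^ m) -
       (\<Sum>\<alpha>\<le>N. f (u + cheb_node N \<alpha> / 2 ^ m) * poly (lagrange_basis N \<alpha>) v)\<bar>"

text \<open>The supremum is a maximum for continuous \<open>f\<close>; see \<open>interp_error_attained\<close>.\<close>

definition interp_error :: "nat \<Rightarrow> nat \<Rightarrow> (real \<Rightarrow> real) \<Rightarrow> real" where
  "interp_error m N f =
     (SUP (u, v)\<in>{0..1 - 1 / 2 ^ m} \<times> {0..1}. interp_residual m N f u v)"

lemma interp_error_attained:
  assumes "continuous_on {0..1} f"
  obtains u v where "u \<in> {0..1 - 1 / 2 ^ m}" "v \<in> {0..1}"
    "interp_error m N f = interp_residual m N f u v"
    "\<And>u' v'. u' \<in> {0..1 - 1 / 2 ^ m} \<Longrightarrow> v' \<in> {0..1} \<Longrightarrow>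
       interp_residual m N f u' v' \<le> interp_residual m N f u v"
proof -
  let ?S = "{0..1 - 1 / 2 ^ m :: real} \<times> {0..1 :: real}"
  let ?g = "\<lambda>p. interp_residual m N f (fst p) (snd p)"
  have node: "0 \<le> cheb_node N \<alpha> \<and> cheb_node N \<alpha> \<le> 1" for \<alpha>
  proof -
    have "0 \<le> (c + 1) / 2 \<and> (c + 1) / 2 \<le> 1" if "-1 \<le> c" "c \<le> 1" for c :: real
      using that by simp
    then show ?thesis
      unfolding cheb_node_def using cos_ge_minus_one cos_le_one by blast
  qed
  have rng: "u + v / 2 ^ m \<in> {0..1}"
    if "0 \<le> u" "u \<le> 1 - 1 / 2 ^ m" "0 \<le> v" "v \<le> 1" for u v :: real
  proof -
    have "v / 2 ^ m \<le> 1 / 2 ^ m" using that by (intro divide_right_mono) auto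
    moreover have "0 \<le> v / 2 ^ m" using that by simp
    ultimately show ?thesis using that by auto
  qed
  have "continuous_on ?S ?g"
    unfolding interp_residual_def
    by (intro continuous_intros continuous_on_compose2[OF assms])
       (use rng node in auto)
  moreover have "compact ?S" by (intro compact_Times compact_Icc)
  moreover have "?S \<noteq> {}" by auto
  ultimately obtain p where p: "p \<in> ?S" "\<And>q. q \<in> ?S \<Longrightarrow> ?g q \<le> ?g p"
    using continuous_attains_sup[of ?S ?g] by blast
  have "interp_error m N f = ?g p"
    unfolding interp_error_def case_prod_unfold
    by (rule cSup_eq_maximum) (use p in auto)
  then show ?thesis
    using p by (intro that[of "fst p" "snd p"]) auto
qed

text \<open>
  The index set \<open>{0,1}\<^sup>K\<close> consists of the lists of length \<open>K\<close> over \<open>{0,1}\<close>; the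
  entry \<open>\<sigma>\<^sub>k\<close> (with \<open>k\<close> counted from 1) is \<open>\<sigma> ! (k - 1)\<close>. A tensor is a function on lists
  of which only the values on this index set are used.
\<close>

definition bits :: "nat \<Rightarrow> nat list set" where
  "bits K = {\<sigma>. set \<sigma> \<subseteq> {0, 1} \<and> length \<sigma> = K}"

definition quantized_tensor :: "nat \<Rightarrow> (real \<Rightarrow> real) \<Rightarrow> nat list \<Rightarrow> real" where
  "quantized_tensor K f \<sigma> = f (\<Sum>k=1..K. (1 / 2) ^ k * real (\<sigma> ! (k - 1)))"

definition tensor_norm :: "nat \<Rightarrow> (nat list \<Rightarrow> real) \<Rightarrow> real" where
  "tensor_norm K S = Max ((\<lambda>\<sigma>. \<bar>S \<sigma>\<bar>) ` bits K)"

definition tensor_prod ::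
    "nat \<Rightarrow> (nat list \<Rightarrow> real) \<Rightarrow> (nat list \<Rightarrow> real) \<Rightarrow> nat list \<Rightarrow> real" where
  "tensor_prod m TL TR \<sigma> = TL (take m \<sigma>) * TR (drop m \<sigma>)"

definition eps_rank :: "nat \<Rightarrow> nat \<Rightarrow> real \<Rightarrow> (nat list \<Rightarrow> real) \<Rightarrow> nat" where
  "eps_rank K m \<epsilon> T =
     (LEAST r. \<exists>TL TR :: nat \<Rightarrow> nat list \<Rightarrow> real.
        tensor_norm K (\<lambda>\<sigma>. T \<sigma> - (\<Sum>\<alpha><r. tensor_prod m (TL \<alpha>) (TR \<alpha>) \<sigma>)) \<le> \<epsilon>)"

end

theory Submission
  imports Defs
begin

text \<open>
  On each subinterval of \<open>[0, 1]\<close> of length \<open>2\<^sup>-\<^sup>m\<close> the function \<open>f\<close> is, after rescaling to \<open>[-1, 1]\<close>, analytic and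
  bounded by \<open>B\<close> on the Bernstein ellipse of the larger parameter \<open>\<rho>\<^sub>m\<close>: if \<open>\<rho>\<^sub>m = \<rho>\<close> this follows from
  the convexity of the ellipse, and otherwise from the fact that the ellipse of parameter \<open>R\<close> lies
  within distance \<open>R / 2\<close> of \<open>[-1, 1]\<close>, whereas the ellipse of parameter \<open>\<rho>\<close> contains every point
  within distance \<open>(\<rho> - 1)\<^sup>2 / (2 * \<rho>)\<close> of \<open>[-1, 1]\<close> (\<open>scaled_bernstein_ellipse_subset\<close>). The error
  bound is thereby reduced to the classical estimate \<open>4 * B * R\<^sup>-\<^sup>N / (R - 1)\<close> for interpolation at the
  Chebyshev-Lobatto points of a function \<open>g\<close> that is holomorphic and bounded by \<open>B\<close> on the ellipse
  of parameter \<open>R\<close> (\<open>chebyshev_interpolation_bound\<close>).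

  For that estimate the Cauchy integral of \<open>g\<close> over the boundary of the ellipse is pulled back along
  \<open>J z = (z + 1 / z) / 2\<close> to the circle of radius \<open>R\<close>, which gives
  \<open>2 * \<pi> * \<i> * g (cos \<theta>) = \<integral> g (J z) * K\<^sub>\<theta> z dz\<close> with a kernel \<open>K\<^sub>\<theta>\<close> whose Laurent expansion is the
  generating function of the Chebyshev polynomials, \<open>K\<^sub>\<theta> z = z\<^sup>-\<^sup>1 + 2 * (\<Sum>k\<ge>1. cos (k * \<theta>) * z\<^sup>-\<^sup>k\<^sup>-\<^sup>1)\<close>.
  The interpolation error is a finite linear combination of point evaluations, so it may be taken
  under the integral and applied to the expansion of the kernel term by term. It vanishes on
  \<open>cos (k * \<theta>)\<close> for \<open>k \<le> N\<close> because interpolation of degree \<open>N\<close> is exact there, and it is at most 2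
  for \<open>k > N\<close> because the interpolant of a Chebyshev polynomial is again a Chebyshev polynomial
  (\<open>cos_alias\<close>). A geometric series remains. No series expansion of \<open>g\<close> itself is needed.

  The rank bound follows since the interpolant in the variable \<open>v\<close> separates the first \<open>m\<close> binary
  digits from the others with \<open>N + 1\<close> terms; \<open>N\<close> is the least positive integer for which the error
  bound is at most \<open>\<epsilon>\<close> (and \<open>N = 1\<close> if \<open>B = 0\<close>).
\<close>

section \<open>Bernstein ellipses\<close>

lemma bernstein_axes:
  fixes R :: real
  assumes "R > 1"
  shows "(R - inverse R) / 2 > 0" "(R + inverse R) / 2 > 1"
proof -
  have "inverse R < 1" using assms by (simp add: inverse_less_1_iff)
  then show "(R - inverse R) / 2 > 0" using assms by simp
  have "(R + inverse R) / 2 - 1 = (R - 1)\<^sup>2 / (2 * R)"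
    using assms by (simp add: field_simps power2_eq_square)
  also have "\<dots> > 0" using assms by simp
  finally show "(R + inverse R) / 2 > 1" by simp
qed

lemma convex_bernstein_ellipse:
  assumes "R > 1"
  shows "convex (bernstein_ellipse R)"
proof -
  let ?a = "(R + inverse R) / 2" and ?b = "(R - inverse R) / 2"
  let ?h = "\<lambda>z. Complex (Re z / ?a) (Im z / ?b)"
  have "linear ?h"
    by (rule linearI) (simp_all add: complex_eq_iff add_divide_distrib)
  then have "convex (?h -` cball 0 1)"
    by (intro convex_linear_vimage convex_cball)
  also have "?h -` cball 0 1 = bernstein_ellipse R"
    by (auto simp: bernstein_ellipse_def complex_norm)
  finally show ?thesis .
qed

lemma interval_strictly_inside:
  fixes R x :: real
  assumes "R > 1" "\<bar>x\<bar> \<le> 1"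
  shows "(x / ((R + inverse R) / 2))\<^sup>2 < 1"
proof -
  define a where "a = (R + inverse R) / 2"
  have "a > 1" using bernstein_axes(2)[OF assms(1)] by (simp add: a_def)
  then have "\<bar>x / a\<bar> < 1" using assms(2) by (simp add: abs_divide)
  then show ?thesis by (simp only: abs_square_less_1 flip: a_def)
qed

lemma interval_in_interior_bernstein_ellipse:
  assumes "R > 1" "\<bar>x\<bar> \<le> 1"
  shows "of_real x \<in> interior (bernstein_ellipse R)"
proof (rule interiorI)
  let ?a = "(R + inverse R) / 2" and ?b = "(R - inverse R) / 2"
  let ?U = "{z. (Re z / ?a)\<^sup>2 + (Im z / ?b)\<^sup>2 < 1}"
  note ab = bernstein_axes[OF assms(1)]
  show "open ?U" by (intro open_Collect_less continuous_intros) (use ab in auto)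
  show "of_real x \<in> ?U" using interval_strictly_inside[OF assms] by simp
  show "?U \<subseteq> bernstein_ellipse R" by (auto simp: bernstein_ellipse_def)
qed

text \<open>
  The distance from \<open>[-1, 1]\<close> to the boundary of the ellipse is \<open>a - 1\<close>, where \<open>a\<close> is the semi-major
  axis; it is attained at the vertices.
\<close>

lemma bernstein_ellipse_contains_neighbourhood:
  assumes "R > 1" "\<bar>p\<bar> \<le> 1" "norm q \<le> (R + inverse R) / 2 - 1"
  shows "of_real p + q \<in> bernstein_ellipse R"
proof -
  define a b d where "a = (R + inverse R) / 2" and "b = (R - inverse R) / 2" and "d = a - 1"
  define t where "t = \<bar>Re q\<bar>"
  define D where "D = d\<^sup>2 + 2 * d"
  have d: "d > 0" using bernstein_axes[OF assms(1)] by (simp add: d_def a_def)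
  have D: "D > 0" using d by (simp add: D_def add_pos_pos)
  have a2: "a\<^sup>2 = D + 1" by (simp add: D_def d_def power2_eq_square algebra_simps)
  have b2: "b\<^sup>2 = D"
  proof -
    have "b\<^sup>2 = a\<^sup>2 - 1"
      using assms(1) by (simp add: a_def b_def field_simps power2_eq_square)
    then show ?thesis by (simp add: a2)
  qed
  have t: "0 \<le> t" "t \<le> d"
    using assms(3) abs_Re_le_cmod[of q] by (auto simp: t_def d_def a_def)
  have "(Re q)\<^sup>2 + (Im q)\<^sup>2 \<le> d\<^sup>2"
    using power_mono[OF assms(3), of 2] by (simp add: d_def a_def cmod_power2)
  then have y: "(Im q)\<^sup>2 \<le> d\<^sup>2 - t\<^sup>2" by (simp add: t_def)
  have "\<bar>p + Re q\<bar> \<le> 1 + t" using assms(2) by (simp add: t_def)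
  then have x: "(p + Re q)\<^sup>2 \<le> (1 + t)\<^sup>2"
    using t by (simp add: abs_le_square_iff[symmetric])
  \<comment> \<open>With \<open>a\<^sup>2 = D + 1\<close> and \<open>b\<^sup>2 = D\<close> it remains to show
      \<open>(1 + t)\<^sup>2 * D + (d\<^sup>2 - t\<^sup>2) * (D + 1) \<le> D * (D + 1)\<close>; the right-hand side minus the left-hand side
      is \<open>(d - t) * (2 * D - d - t)\<close>.\<close>
  have "2 * d \<le> D" by (simp add: D_def)
  then have "d + t \<le> 2 * D" using t d by linarith
  then have "0 \<le> (d - t) * (2 * D - d - t)"
    using t by (intro mult_nonneg_nonneg) auto
  then have "(1 + t)\<^sup>2 * D + (d\<^sup>2 - t\<^sup>2) * (D + 1) \<le> D * (D + 1)"
    by (simp add: D_def power2_eq_square algebra_simps)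
  moreover have "(p + Re q)\<^sup>2 * D \<le> (1 + t)\<^sup>2 * D"
    using x D by (intro mult_right_mono) auto
  moreover have "(Im q)\<^sup>2 * (D + 1) \<le> (d\<^sup>2 - t\<^sup>2) * (D + 1)"
    using y D by (intro mult_right_mono) auto
  ultimately have "(p + Re q)\<^sup>2 * D + (Im q)\<^sup>2 * (D + 1) \<le> D * (D + 1)" by linarith
  then have "((p + Re q)\<^sup>2 * D + (Im q)\<^sup>2 * (D + 1)) / ((D + 1) * D) \<le> 1"
    using D by (subst divide_le_eq_1_pos) (auto simp: mult.commute)
  then have "(p + Re q)\<^sup>2 / (D + 1) + (Im q)\<^sup>2 / D \<le> 1"
    using D by (subst add_frac_eq) auto
  then show ?thesis
    by (simp add: bernstein_ellipse_def power_divide flip: a_def b_def a2 b2)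
       (simp add: a2 b2)
qed

lemma bernstein_ellipse_near_interval:
  assumes "R > 1" "z \<in> bernstein_ellipse R"
  obtains p where "\<bar>p\<bar> \<le> 1" "norm (z - of_real p) \<le> R / 2"
proof -
  define a b where "a = (R + inverse R) / 2" and "b = (R - inverse R) / 2"
  have ab: "b > 0" "a > 1" "b \<le> R / 2" "a - inverse R = b"
    using bernstein_axes[OF assms(1)] assms(1) by (auto simp: a_def b_def field_simps)
  have z: "(Re z / a)\<^sup>2 + (Im z / b)\<^sup>2 \<le> 1"
    using assms(2) by (simp add: bernstein_ellipse_def a_def b_def)
  then have "(Re z / a)\<^sup>2 \<le> 1" using zero_le_power2[of "Im z / b"] by linarith
  then have za: "\<bar>Re z / a\<bar> \<le> 1" by (simp add: abs_square_le_1)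
  \<comment> \<open>With this choice \<open>z - p\<close> is \<open>b\<close> times a vector of length at most 1, as \<open>a - 1 / R = b\<close>.\<close>
  define p where "p = Re z / a / R"
  have "\<bar>p\<bar> = \<bar>Re z / a\<bar> / R"
    unfolding p_def using assms(1) by (subst abs_divide) simp
  moreover have "\<bar>Re z / a\<bar> / R \<le> 1"
    using za assms(1) by (subst divide_le_eq_1_pos) linarith+
  ultimately have p: "\<bar>p\<bar> \<le> 1" by simp
  have "Re z - p = Re z / a * (a - inverse R)"
    using ab(2) by (simp add: p_def right_diff_distrib divide_inverse)
  then have re: "Re z - p = b * (Re z / a)" using ab by simp
  have im: "Im z = b * (Im z / b)" using ab by simp
  have "(norm (z - of_real p))\<^sup>2 = (Re z - p)\<^sup>2 + (Im z)\<^sup>2" by (simp add: cmod_power2)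
  also have "\<dots> = (b * (Re z / a))\<^sup>2 + (b * (Im z / b))\<^sup>2"
    by (rule arg_cong2[where f = "\<lambda>x y. x\<^sup>2 + y\<^sup>2", OF re im])
  also have "\<dots> = b\<^sup>2 * ((Re z / a)\<^sup>2 + (Im z / b)\<^sup>2)"
    by (simp only: power_mult_distrib distrib_left)
  also have "\<dots> \<le> b\<^sup>2 * 1" by (intro mult_left_mono z) auto
  finally have "norm (z - of_real p) \<le> b" using ab by (simp add: power2_le_iff_abs_le)
  with p ab show ?thesis by (intro that) auto
qed

lemma rho_level_gt_1:
  assumes "\<rho> > 1"
  shows "rho_level \<rho> m > 1"
  using assms by (simp add: rho_level_def)

text \<open>
  The subintervals of \<open>[-1, 1]\<close> of length \<open>2 * 2\<^sup>-\<^sup>m\<close> are parametrized here by their midpoint \<open>c\<close>.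
\<close>

lemma scaled_bernstein_ellipse_subset:
  assumes "\<rho> > 1" "z \<in> bernstein_ellipse (rho_level \<rho> m)" "\<bar>c\<bar> \<le> 1 - 1 / 2 ^ m"
  shows "of_real c + z / 2 ^ m \<in> bernstein_ellipse \<rho>"
proof (cases "rho_level \<rho> m = \<rho>")
  case True
  define s :: real where "s = 1 / 2 ^ m"
  have s: "0 < s" "s \<le> 1" by (auto simp: s_def)
  define e where "e = c / (1 - s)"
  have "\<bar>e\<bar> \<le> 1" "(1 - s) * e = c"
    using assms(3) s by (cases "s = 1"; force simp: e_def s_def[symmetric] field_simps)+
  moreover have "of_real e \<in> bernstein_ellipse \<rho>"
    using interval_in_interior_bernstein_ellipse[OF assms(1), of e] \<open>\<bar>e\<bar> \<le> 1\<close> interior_subset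
    by blast
  ultimately have "(1 - s) *\<^sub>R of_real e + s *\<^sub>R z \<in> bernstein_ellipse \<rho>"
    using convexD_alt[OF convex_bernstein_ellipse[OF assms(1)], of "of_real e" z s] assms(2) True s
    by auto
  moreover have "(1 - s) *\<^sub>R of_real e + s *\<^sub>R z = of_real ((1 - s) * e) + z / 2 ^ m"
    by (simp add: s_def scaleR_conv_of_real)
  ultimately show ?thesis using \<open>(1 - s) * e = c\<close> by simp
next
  case False
  define R where "R = rho_level \<rho> m"
  have R: "R > 1" "R = 2 ^ m * ((\<rho> - 1)\<^sup>2 / \<rho>)"
    using rho_level_gt_1[OF assms(1), of m] False unfolding R_def rho_level_def by linarith+
  obtain p where p: "\<bar>p\<bar> \<le> 1" "norm (z - of_real p) \<le> R / 2"
    using bernstein_ellipse_near_interval[OF R(1)] assms(2) by (auto simp: R_def)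
  have "\<bar>p / 2 ^ m\<bar> \<le> 1 / 2 ^ m" using p(1) by (simp add: abs_divide divide_right_mono)
  then have "\<bar>c + p / 2 ^ m\<bar> \<le> 1" using assms(3) by linarith
  moreover have "norm ((z - of_real p) / 2 ^ m) \<le> (\<rho> + inverse \<rho>) / 2 - 1"
  proof -
    have "norm ((z - of_real p) / 2 ^ m) \<le> R / 2 / 2 ^ m"
      using divide_right_mono[OF p(2), of "2 ^ m"] by (simp add: norm_divide norm_power)
    also have "\<dots> = (\<rho> - 1)\<^sup>2 / \<rho> / 2" by (simp add: R(2))
    also have "\<dots> = (\<rho> + inverse \<rho>) / 2 - 1"
      using assms(1) by (simp add: field_simps power2_eq_square)
    finally show ?thesis .
  qed
  ultimately have "of_real (c + p / 2 ^ m) + (z - of_real p) / 2 ^ m \<in> bernstein_ellipse \<rho>"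
    by (rule bernstein_ellipse_contains_neighbourhood[OF assms(1)])
  then show ?thesis by (simp add: diff_divide_distrib)
qed

section \<open>Cauchy's formula in the Joukowski variable\<close>

text \<open>
  The Joukowski map, which sends the circle of radius \<open>R\<close> around 0 to the boundary of the Bernstein
  ellipse of parameter \<open>R\<close> and \<open>cis \<theta>\<close> to \<open>cos \<theta>\<close>.
\<close>

definition joukowski :: "complex \<Rightarrow> complex" where
  "joukowski z = (z + 1 / z) / 2"

text \<open>
  The Cauchy kernel at \<open>cos \<theta>\<close>, pulled back along the Joukowski map (\<open>joukowski_kernel\<close>) and written
  in partial fractions.
\<close>

definition cheb_kernel :: "real \<Rightarrow> complex \<Rightarrow> complex" where
  "cheb_kernel \<theta> z = 1 / (z - cis \<theta>) + 1 / (z - cis (- \<theta>)) - 1 / z"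

lemma joukowski_on_circle:
  assumes "R > 1" "norm z = R"
  shows "(Re (joukowski z) / ((R + inverse R) / 2))\<^sup>2 +
         (Im (joukowski z) / ((R - inverse R) / 2))\<^sup>2 = 1"
proof -
  note ab = bernstein_axes[OF assms(1)]
  have n: "(Re z)\<^sup>2 + (Im z)\<^sup>2 = R\<^sup>2" using assms(2) by (simp flip: cmod_power2)
  have inv: "Re (1 / z) = Re z / R\<^sup>2" "Im (1 / z) = - Im z / R\<^sup>2"
    by (simp_all add: Re_divide Im_divide n)
  have "Re (joukowski z) / ((R + inverse R) / 2) = Re z / R"
  proof -
    have "Re (joukowski z) = Re z / R * ((R + inverse R) / 2)"
      using assms(1) by (simp add: joukowski_def inv field_simps power2_eq_square)
    then show ?thesis using ab by simp
  qed
  moreover have "Im (joukowski z) / ((R - inverse R) / 2) = Im z / R"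
  proof -
    have "Im (joukowski z) = Im z / R * ((R - inverse R) / 2)"
      using assms(1) by (simp add: joukowski_def inv field_simps power2_eq_square)
    then show ?thesis using ab by simp
  qed
  ultimately show ?thesis
    using assms(1) n by (simp add: power_divide flip: add_divide_distrib)
qed

lemma joukowski_in_ellipse:
  assumes "R > 1" "norm z = R"
  shows "joukowski z \<in> bernstein_ellipse R"
  using joukowski_on_circle[OF assms] by (simp add: bernstein_ellipse_def)

lemma joukowski_neq_interval:
  assumes "R > 1" "norm z = R" "\<bar>x\<bar> \<le> 1"
  shows "joukowski z \<noteq> of_real x"
proof
  assume eq: "joukowski z = of_real x"
  show False
    using interval_strictly_inside[OF assms(1,3)] joukowski_on_circle[OF assms(1,2)]
    by (simp add: eq)
qed

lemma has_field_derivative_joukowski: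
  assumes "z \<noteq> 0"
  shows "(joukowski has_field_derivative (1 - 1 / z\<^sup>2) / 2) (at z)"
  unfolding joukowski_def [abs_def]
  by (rule derivative_eq_intros refl | use assms in \<open>simp add: power2_eq_square field_simps\<close>)+

lemma joukowski_kernel:
  assumes "norm z > 1"
  shows "(1 - 1 / z\<^sup>2) / 2 / (joukowski z - of_real (cos \<theta>)) = cheb_kernel \<theta> z"
proof -
  have ne: "z \<noteq> 0" "z - cis \<theta> \<noteq> 0" "z - cis (- \<theta>) \<noteq> 0"
    using assms by (auto simp: norm_cis)
  have s: "cis \<theta> + cis (- \<theta>) = 2 * of_real (cos \<theta>)" and p: "cis \<theta> * cis (- \<theta>) = 1"
    by (simp_all add: complex_eq_iff cis_mult)
  define P where "P = (z - cis \<theta>) * (z - cis (- \<theta>))"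
  have P: "P \<noteq> 0" using ne by (simp add: P_def)
  have "P = z\<^sup>2 - (cis \<theta> + cis (- \<theta>)) * z + cis \<theta> * cis (- \<theta>)"
    by (simp only: P_def power2_eq_square algebra_simps)
  then have prod: "P = z\<^sup>2 - 2 * of_real (cos \<theta>) * z + 1" by (simp only: s p)
  have "joukowski z - of_real (cos \<theta>) = P / (2 * z)"
    unfolding prod joukowski_def using ne(1) by (simp add: field_simps power2_eq_square)
  then have "(1 - 1 / z\<^sup>2) / 2 / (joukowski z - of_real (cos \<theta>)) = (z\<^sup>2 - 1) / (z * P)"
    using ne(1) P by (simp add: field_simps power2_eq_square)
  also have "z\<^sup>2 - 1 = z * (2 * z - (cis \<theta> + cis (- \<theta>))) - P"
    unfolding s prod by (simp add: power2_eq_square algebra_simps)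
  also have "\<dots> / (z * P) = cheb_kernel \<theta> z"
    using ne by (simp add: P_def cheb_kernel_def divide_simps del: right_minus_eq)
  finally show ?thesis .
qed

lemma has_contour_integral_cheb_kernel:
  assumes "R > 1"
  shows "(cheb_kernel \<theta> has_contour_integral 2 * pi * \<i>) (circlepath 0 R)"
proof -
  have *: "((\<lambda>z. 1 / (z - w)) has_contour_integral 2 * pi * \<i>) (circlepath 0 R)"
    if "norm w < R" for w
    using Cauchy_integral_circlepath_simple[of "\<lambda>_. 1" 0 R w] that by simp
  have "(cheb_kernel \<theta> has_contour_integral 2 * pi * \<i> + 2 * pi * \<i> - 2 * pi * \<i>) (circlepath 0 R)"
    unfolding cheb_kernel_def [abs_def]
    by (intro has_contour_integral_diff has_contour_integral_add *)
       (use assms *[of 0] in \<open>auto simp: norm_cis\<close>)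
  then show ?thesis by (simp add: mult_ac)
qed

text \<open>
  This is Cauchy's formula in the convex ellipse for the path that runs once around its boundary.
\<close>

lemma Cauchy_integral_joukowski:
  assumes R: "R > 1" and g: "g holomorphic_on bernstein_ellipse R"
  shows "((\<lambda>z. g (joukowski z) * cheb_kernel \<theta> z) has_contour_integral
           2 * pi * \<i> * g (of_real (cos \<theta>))) (circlepath 0 R)"
proof -
  let ?x = "complex_of_real (cos \<theta>)"
  let ?\<gamma> = "joukowski \<circ> circlepath 0 R"
  have circ: "norm z = R \<longleftrightarrow> z \<in> path_image (circlepath 0 R)" for z
    using R by simp
  have deriv: "deriv joukowski z = (1 - 1 / z\<^sup>2) / 2" if "z \<noteq> 0" for z
    by (rule DERIV_imp_deriv[OF has_field_derivative_joukowski[OF that]])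
  have ana: "joukowski analytic_on - {0}"
  proof -
    have "joukowski holomorphic_on - {0}"
      unfolding holomorphic_on_def field_differentiable_def
      using has_field_derivative_joukowski by (blast intro: has_field_derivative_at_within)
    moreover have "open (- {0 :: complex})" by (intro open_Compl) simp
    ultimately show ?thesis by (simp only: analytic_on_open)
  qed
  have path: "path_image (circlepath 0 R) \<subseteq> - {0}" using R by auto
  have vp: "valid_path ?\<gamma>"
    by (rule valid_path_compose_analytic[OF _ ana path]) simp
  have pimg: "path_image ?\<gamma> \<subseteq> bernstein_ellipse R - {?x}"
    using joukowski_in_ellipse[OF R] joukowski_neq_interval[OF R, of _ "cos \<theta>"] circ
    by (auto simp: path_image_compose)
  have formula: "contour_integral ?\<gamma> (\<lambda>w. h w / (w - ?x)) =
      2 * pi * \<i> * winding_number ?\<gamma> ?x * h ?x"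
    if "h holomorphic_on bernstein_ellipse R" for h
    by (rule contour_integral_unique, rule Cauchy_integral_formula_convex_simple
          [OF convex_bernstein_ellipse[OF R] that
             interval_in_interior_bernstein_ellipse[OF R] vp pimg])
       (auto simp: pathfinish_compose pathstart_compose)
  have subst: "contour_integral ?\<gamma> (\<lambda>w. h w / (w - ?x)) =
      contour_integral (circlepath 0 R) (\<lambda>z. h (joukowski z) * cheb_kernel \<theta> z)" for h
  proof -
    have "contour_integral ?\<gamma> (\<lambda>w. h w / (w - ?x)) = contour_integral (circlepath 0 R)
        (\<lambda>z. deriv joukowski z * (h (joukowski z) / (joukowski z - ?x)))"
      by (rule contour_integral_comp_analyticW[OF ana _ path]) simp
    also have "\<dots> = contour_integral (circlepath 0 R)
        (\<lambda>z. h (joukowski z) * cheb_kernel \<theta> z)"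
    proof (rule contour_integral_eq)
      fix z assume "z \<in> path_image (circlepath 0 R)"
      then have "norm z = R" using circ by blast
      then have "norm z > 1" using R by (simp only:)
      then have "z \<noteq> 0" by auto
      have "cheb_kernel \<theta> z = deriv joukowski z / (joukowski z - ?x)"
        unfolding deriv[OF \<open>z \<noteq> 0\<close>] by (rule joukowski_kernel[symmetric]) fact
      then show "deriv joukowski z * (h (joukowski z) / (joukowski z - ?x)) =
          h (joukowski z) * cheb_kernel \<theta> z"
        by (simp only: times_divide_eq_right mult.commute)
    qed
    finally show ?thesis .
  qed
  \<comment> \<open>Both formulas, applied to the constant function 1, determine the winding number.\<close>
  have "winding_number ?\<gamma> ?x = 1"
    using formula[of "\<lambda>_. 1"] subst[of "\<lambda>_. 1"]
      contour_integral_unique[OF has_contour_integral_cheb_kernel[OF R, of \<theta>]]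
    by simp
  then have "contour_integral (circlepath 0 R) (\<lambda>z. g (joukowski z) * cheb_kernel \<theta> z) =
      2 * pi * \<i> * g ?x"
    using formula[OF g] subst[of g] by simp
  moreover have "(\<lambda>z. g (joukowski z) * cheb_kernel \<theta> z) contour_integrable_on circlepath 0 R"
  proof (rule contour_integrable_continuous_circlepath)
    have J: "continuous_on (path_image (circlepath 0 R)) joukowski"
      by (rule holomorphic_on_imp_continuous_on,
          rule holomorphic_on_subset[OF analytic_imp_holomorphic[OF ana] path])
    have "continuous_on (path_image (circlepath 0 R)) (\<lambda>z. g (joukowski z))"
      by (rule continuous_on_compose2[OF holomorphic_on_imp_continuous_on[OF g] J])
         (use joukowski_in_ellipse[OF R] circ in blast)
    moreover have "continuous_on (path_image (circlepath 0 R)) (cheb_kernel \<theta>)"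
      unfolding cheb_kernel_def [abs_def]
      by (intro continuous_intros) (use R in \<open>auto simp: norm_cis\<close>)
    ultimately show "continuous_on (path_image (circlepath 0 R))
        (\<lambda>z. g (joukowski z) * cheb_kernel \<theta> z)"
      by (rule continuous_on_mult)
  qed
  ultimately show ?thesis by (metis has_contour_integral_integral)
qed

lemma cheb_kernel_sums:
  assumes "norm z > 1"
  shows "(\<lambda>k. (if k = 0 then 1 else 2) * of_real (cos (real k * \<theta>)) / z ^ Suc k)
           sums cheb_kernel \<theta> z"
proof -
  have geo: "(\<lambda>k. w ^ k / z ^ Suc k) sums (1 / (z - w))" if "norm w = 1" for w
  proof -
    have "z \<noteq> 0" "z \<noteq> w" using assms that by auto
    have "norm (w / z) < 1" using assms that \<open>z \<noteq> 0\<close> by (simp add: norm_divide)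
    then have "(\<lambda>k. 1 / z * (w / z) ^ k) sums (1 / z * (1 / (1 - w / z)))"
      by (intro sums_mult geometric_sums)
    then show ?thesis using \<open>z \<noteq> 0\<close> \<open>z \<noteq> w\<close> by (simp add: field_simps)
  qed
  have "(\<lambda>k. cis \<theta> ^ k / z ^ Suc k + cis (- \<theta>) ^ k / z ^ Suc k - (if k = 0 then 1 / z else 0))
      sums cheb_kernel \<theta> z"
    unfolding cheb_kernel_def
    by (intro sums_diff sums_add geo sums_If_finite[of "\<lambda>k. k = 0" "\<lambda>_. 1 / z", simplified])
       (simp_all add: norm_cis)
  moreover have "cis \<theta> ^ k / z ^ Suc k + cis (- \<theta>) ^ k / z ^ Suc k - (if k = 0 then 1 / z else 0)
      = (if k = 0 then 1 else 2) * of_real (cos (real k * \<theta>)) / z ^ Suc k" for k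
  proof -
    have "cis \<theta> ^ k + cis (- \<theta>) ^ k = 2 * of_real (cos (real k * \<theta>))"
      by (simp add: Complex.DeMoivre complex_eq_iff)
    then show ?thesis by (cases "k = 0") (simp_all flip: add_divide_distrib)
  qed
  ultimately show ?thesis by simp
qed

section \<open>The interpolation error functional\<close>

text \<open>
  The error at \<open>(cos \<theta> + 1) / 2\<close> of interpolation in the Chebyshev-Lobatto points of \<open>[0, 1]\<close>, as a
  linear functional of the interpolated function. The latter is given as a function \<open>\<phi>\<close> of the angle,
  so that the node with index \<open>\<alpha>\<close> is the angle \<open>\<pi> * \<alpha> / N\<close>.
\<close>

definition interp_defect :: "nat \<Rightarrow> real \<Rightarrow> (real \<Rightarrow> complex) \<Rightarrow> complex" where
  "interp_defect N \<theta> \<phi> = \<phi> \<theta> -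
     (\<Sum>\<alpha>\<le>N. \<phi> (pi * real \<alpha> / real N) *
        of_real (poly (lagrange_basis N \<alpha>) ((cos \<theta> + 1) / 2)))"

lemma lagrange_interpolation_exact:
  assumes "degree p \<le> N"
  shows "(\<Sum>\<alpha>\<le>N. poly p (cheb_node N \<alpha>) * poly (lagrange_basis N \<alpha>) x) = poly p x"
proof -
  let ?q = "\<Sum>\<alpha>\<le>N. smult (poly p (cheb_node N \<alpha>)) (lagrange_basis N \<alpha>)"
  have inj: "inj_on (cheb_node N) {..N}" by (auto intro!: inj_onI cheb_node_inj)
  have "?q = p"
  proof (rule poly_eqI_degree[where A = "cheb_node N ` {..N}"])
    fix x assume "x \<in> cheb_node N ` {..N}"
    then obtain \<beta> where \<beta>: "\<beta> \<le> N" "x = cheb_node N \<beta>" by auto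
    have "poly ?q x = (\<Sum>\<alpha>\<le>N. poly p (cheb_node N \<alpha>) * (if \<alpha> = \<beta> then 1 else 0))"
      unfolding poly_sum \<beta>(2)
      by (intro sum.cong refl) (simp add: poly_lagrange_basis_node \<beta>(1))
    then show "poly ?q x = poly p x" using \<beta> by (simp add: if_distrib cong: if_cong)
  next
    have "degree ?q \<le> N"
      by (intro degree_sum_le) (auto intro: order.trans[OF degree_smult_le] simp: degree_lagrange_basis)
    then show "card (cheb_node N ` {..N}) > degree ?q" by (simp add: card_image[OF inj])
    show "card (cheb_node N ` {..N}) > degree p" using assms by (simp add: card_image[OF inj])
  qed
  then have "poly p x = poly ?q x" by simp
  then show ?thesis by (simp add: poly_sum)
qed

text \<open>The Chebyshev polynomials, transported from \<open>[-1, 1]\<close> to \<open>[0, 1]\<close>.\<close>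

lemma chebyshev_polynomial_exists:
  "\<exists>p :: real poly. degree p \<le> k \<and> (\<forall>\<theta>. poly p ((cos \<theta> + 1) / 2) = cos (real k * \<theta>))"
proof (induction k rule: induct_nat_012)
  case 0
  show ?case by (intro exI[of _ 1]) auto
next
  case 1
  show ?case by (intro exI[of _ "[:-1, 2:]"]) (auto simp: field_simps)
next
  case (ge2 k)
  then obtain p q :: "real poly" where
    p: "degree p \<le> k" "\<And>\<theta>. poly p ((cos \<theta> + 1) / 2) = cos (real k * \<theta>)" and
    q: "degree q \<le> Suc k" "\<And>\<theta>. poly q ((cos \<theta> + 1) / 2) = cos (real (Suc k) * \<theta>)"
    by blast
  let ?r = "[:-2, 4:] * q - p"
  have "degree ?r \<le> Suc (Suc k)"
    by (intro degree_diff_le order.trans[OF degree_mult_le]) (use p q in auto)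
  moreover have "poly ?r ((cos \<theta> + 1) / 2) = cos (real (Suc (Suc k)) * \<theta>)" for \<theta>
  proof -
    have "cos (real (Suc (Suc k)) * \<theta>) + cos (real k * \<theta>) = 2 * cos \<theta> * cos (real (Suc k) * \<theta>)"
      using cos_add[of "real (Suc k) * \<theta>" \<theta>] cos_diff[of "real (Suc k) * \<theta>" \<theta>]
      by (simp add: algebra_simps)
    moreover have "poly ?r ((cos \<theta> + 1) / 2) =
        2 * cos \<theta> * poly q ((cos \<theta> + 1) / 2) - poly p ((cos \<theta> + 1) / 2)"
      by (simp add: field_simps)
    ultimately show ?thesis by (simp add: p q)
  qed
  ultimately show ?case by blast
qed

lemma lagrange_interpolation_cos:
  assumes "k \<le> N"
  shows "(\<Sum>\<alpha>\<le>N. cos (real k * (pi * real \<alpha> / real N)) *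
            poly (lagrange_basis N \<alpha>) ((cos \<theta> + 1) / 2)) = cos (real k * \<theta>)"
proof -
  obtain p :: "real poly" where p: "degree p \<le> k"
    "\<And>\<theta>. poly p ((cos \<theta> + 1) / 2) = cos (real k * \<theta>)"
    using chebyshev_polynomial_exists by blast
  show ?thesis
    using lagrange_interpolation_exact[of p N "(cos \<theta> + 1) / 2"] p assms
    by (simp add: cheb_node_def)
qed

text \<open>
  Aliasing: on the grid of angles \<open>\<pi> * \<alpha> / N\<close> every cosine coincides with one of frequency at most
  \<open>N\<close>, so that the interpolant of a Chebyshev polynomial is a Chebyshev polynomial. The frequency
  \<open>k\<close> is first reduced modulo \<open>2 * N\<close> and then reflected if necessary.
\<close>

lemma cos_alias:
  assumes "N \<ge> 1"
  obtains j where "j \<le> N"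
    "\<And>\<alpha> :: nat. cos (real k * (pi * real \<alpha> / real N)) = cos (real j * (pi * real \<alpha> / real N))"
proof -
  define r where "r = k mod (2 * N)"
  have r: "r < 2 * N" using assms by (simp add: r_def)
  have k: "real k = real r + 2 * real N * real (k div (2 * N))"
    using mult_div_mod_eq[of "2 * N" k, folded r_def] by (metis add.commute of_nat_add of_nat_mult of_nat_numeral)
  have 1: "cos (real k * (pi * real \<alpha> / real N)) = cos (real r * (pi * real \<alpha> / real N))" for \<alpha>
  proof -
    have "real k * (pi * real \<alpha> / real N) =
        real r * (pi * real \<alpha> / real N) + 2 * pi * real (k div (2 * N) * \<alpha>)"
      unfolding k using assms by (simp add: field_simps)
    then show ?thesis
      by (metis cos.periodic_simps(1) cos_add cos_int_2pin mult_1_right mult_zero_right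
          of_int_of_nat_eq sin_int_2pin diff_zero)
  qed
  show ?thesis
  proof (cases "r \<le> N")
    case True
    then show ?thesis using 1 that by blast
  next
    case False
    have "cos (real r * (pi * real \<alpha> / real N)) = cos (real (2 * N - r) * (pi * real \<alpha> / real N))"
      for \<alpha>
    proof -
      have "real (2 * N - r) * (pi * real \<alpha> / real N) =
          2 * pi * real \<alpha> - real r * (pi * real \<alpha> / real N)"
        using r assms by (simp add: of_nat_diff field_simps)
      then show ?thesis
        using cos_int_2pin[of "int \<alpha>"] sin_int_2pin[of "int \<alpha>"] by (simp add: cos_diff)
    qed
    then show ?thesis using 1 False by (intro that[of "2 * N - r"]) auto
  qed
qed

lemma interp_defect_cos:
  assumes "N \<ge> 1"
  shows "norm (interp_defect N \<theta> (\<lambda>t. of_real (cos (real k * t)))) \<le> (if k \<le> N then 0 else 2)"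
proof -
  obtain j where j: "j \<le> N"
    "\<And>\<alpha> :: nat. cos (real k * (pi * real \<alpha> / real N)) = cos (real j * (pi * real \<alpha> / real N))"
    using cos_alias[OF assms] by blast
  have eq: "interp_defect N \<theta> (\<lambda>t. of_real (cos (real k * t))) =
      of_real (cos (real k * \<theta>) - (\<Sum>\<alpha>\<le>N. cos (real k * (pi * real \<alpha> / real N)) *
            poly (lagrange_basis N \<alpha>) ((cos \<theta> + 1) / 2)))"
    by (simp add: interp_defect_def)
  show ?thesis
  proof (cases "k \<le> N")
    case True
    then show ?thesis unfolding eq lagrange_interpolation_cos[OF True] by simp
  next
    case False
    have "\<bar>cos (real k * \<theta>) - cos (real j * \<theta>)\<bar> \<le> \<bar>cos (real k * \<theta>)\<bar> + \<bar>cos (real j * \<theta>)\<bar>"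
      by (rule abs_triangle_ineq4)
    also have "\<dots> \<le> 1 + 1" by (intro add_mono abs_cos_le_one)
    finally show ?thesis
      using False unfolding eq j(2) lagrange_interpolation_cos[OF j(1)] norm_of_real by simp
  qed
qed

lemma interp_defect_cheb_kernel:
  assumes "N \<ge> 1" "R > 1" "norm z = R"
  shows "norm (interp_defect N \<theta> (\<lambda>t. cheb_kernel t z)) \<le> 4 / (R ^ Suc N * (R - 1))"
proof -
  let ?c = "\<lambda>k. (if k = 0 then 1 else 2) / z ^ Suc k"
  let ?L = "\<lambda>k. interp_defect N \<theta> (\<lambda>t. of_real (cos (real k * t)))"
  have K: "(\<lambda>k. ?c k * of_real (cos (real k * t))) sums cheb_kernel t z" for t
    using cheb_kernel_sums[of z t] assms by simp
  have "(\<lambda>k. ?c k * ?L k) sums interp_defect N \<theta> (\<lambda>t. cheb_kernel t z)"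
  proof -
    have "(\<lambda>k. ?c k * of_real (cos (real k * \<theta>)) -
        (\<Sum>\<alpha>\<le>N. ?c k * of_real (cos (real k * (pi * real \<alpha> / real N))) *
          of_real (poly (lagrange_basis N \<alpha>) ((cos \<theta> + 1) / 2))))
        sums interp_defect N \<theta> (\<lambda>t. cheb_kernel t z)"
      unfolding interp_defect_def by (intro sums_diff sums_sum sums_mult2 K)
    then show ?thesis
      by (simp add: interp_defect_def right_diff_distrib sum_distrib_left mult.assoc)
  qed
  moreover have "(\<lambda>k. if k \<le> N then 0 else 4 / R ^ Suc k) sums (4 / (R ^ Suc N * (R - 1)))"
  proof -
    have "(\<lambda>k. 4 / R ^ Suc (Suc N) * (1 / R) ^ k) sums (4 / R ^ Suc (Suc N) * (1 / (1 - 1 / R)))"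
      by (intro sums_mult geometric_sums) (use assms(2) in auto)
    also have "4 / R ^ Suc (Suc N) * (1 / (1 - 1 / R)) = 4 / (R ^ Suc N * (R - 1))"
      using assms(2) by (simp add: field_simps)
    also have "(\<lambda>k. 4 / R ^ Suc (Suc N) * (1 / R) ^ k) =
        (\<lambda>k. if k + Suc N \<le> N then 0 else 4 / R ^ Suc (k + Suc N))"
      by (auto simp: power_add field_simps)
    finally show ?thesis by (subst (asm) sums_iff_shift) simp
  qed
  moreover have "norm (?c k * ?L k) \<le> (if k \<le> N then 0 else 4 / R ^ Suc k)" for k
  proof -
    have "norm (?c k) \<le> 2 / R ^ Suc k"
      using assms(2,3) by (simp add: norm_divide norm_mult norm_power divide_right_mono)
    then have "norm (?c k * ?L k) \<le> 2 / R ^ Suc k * (if k \<le> N then 0 else 2)"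
      unfolding norm_mult by (intro mult_mono interp_defect_cos assms) (use assms(2) in auto)
    then show ?thesis by (simp split: if_splits)
  qed
  ultimately show ?thesis by (rule norm_sums_le)
qed

theorem chebyshev_interpolation_bound:
  assumes "N \<ge> 1" "R > 1" "g holomorphic_on bernstein_ellipse R"
    and "\<And>z. z \<in> bernstein_ellipse R \<Longrightarrow> norm (g z) \<le> B" and "B \<ge> 0"
  shows "norm (interp_defect N \<theta> (\<lambda>t. g (of_real (cos t)))) \<le> 4 * B / (R ^ N * (R - 1))"
proof -
  let ?L = "interp_defect N \<theta>"
  have "((\<lambda>z. g (joukowski z) * cheb_kernel \<theta> z -
        (\<Sum>\<alpha>\<le>N. g (joukowski z) * cheb_kernel (pi * real \<alpha> / real N) z *
          of_real (poly (lagrange_basis N \<alpha>) ((cos \<theta> + 1) / 2))))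
      has_contour_integral
       (2 * pi * \<i> * g (of_real (cos \<theta>)) -
        (\<Sum>\<alpha>\<le>N. 2 * pi * \<i> * g (of_real (cos (pi * real \<alpha> / real N))) *
          of_real (poly (lagrange_basis N \<alpha>) ((cos \<theta> + 1) / 2))))) (circlepath 0 R)"
    by (intro has_contour_integral_diff has_contour_integral_sum has_contour_integral_rmul
          Cauchy_integral_joukowski assms finite_atMost)
  then have int: "((\<lambda>z. g (joukowski z) * ?L (\<lambda>t. cheb_kernel t z)) has_contour_integral
      2 * pi * \<i> * ?L (\<lambda>t. g (of_real (cos t)))) (circlepath 0 R)"
    by (simp add: interp_defect_def right_diff_distrib sum_distrib_left mult.assoc)
  have "norm (2 * pi * \<i> * ?L (\<lambda>t. g (of_real (cos t)))) \<le>
      B * (4 / (R ^ Suc N * (R - 1))) * (2 * pi * R)"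
  proof (rule has_contour_integral_bound_circlepath[OF int])
    fix z :: complex assume "norm (z - 0) = R"
    then show "norm (g (joukowski z) * ?L (\<lambda>t. cheb_kernel t z)) \<le>
        B * (4 / (R ^ Suc N * (R - 1)))"
      unfolding norm_mult
      by (intro mult_mono assms interp_defect_cheb_kernel joukowski_in_ellipse) auto
  qed (use assms in auto)
  also have "\<dots> = 2 * pi * (4 * B / (R ^ N * (R - 1)))"
    using assms(2) by (simp add: field_simps)
  finally have "2 * pi * norm (?L (\<lambda>t. g (of_real (cos t)))) \<le>
      2 * pi * (4 * B / (R ^ N * (R - 1)))"
    by (simp add: norm_mult)
  then show ?thesis by (rule mult_left_le_imp_le) simp
qed

section \<open>Local interpolation and the rank bound\<close>

lemma interp_residual_le:
  fixes \<rho> B :: real and f :: "real \<Rightarrow> real" and F :: "complex \<Rightarrow> complex"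
  assumes "\<rho> > 1"
    and F: "F analytic_on unit_bernstein_ellipse \<rho>"
    and Ff: "\<forall>x\<in>{0..1}. F (of_real x) = of_real (f x)"
    and "B \<ge> 0"
    and B: "\<forall>z\<in>unit_bernstein_ellipse \<rho>. norm (F z) \<le> B"
    and "N \<ge> 1" and u: "u \<in> {0..1 - 1 / 2 ^ m}" and v: "v \<in> {0..1}"
  shows "interp_residual m N f u v \<le> 4 * B / (rho_level \<rho> m ^ N * (rho_level \<rho> m - 1))"
proof -
  define R where "R = rho_level \<rho> m"
  have R: "R > 1" using rho_level_gt_1[OF assms(1)] by (simp add: R_def)
  define \<Phi> :: "complex \<Rightarrow> complex" where "\<Phi> = (\<lambda>z. of_real u + (z + 1) / 2 / 2 ^ m)"
  have \<Phi>: "\<Phi> z \<in> unit_bernstein_ellipse \<rho>" if "z \<in> bernstein_ellipse R" for z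
  proof -
    \<comment> \<open>The midpoint of the interval \<open>[u, u + 2\<^sup>-\<^sup>m]\<close>, transported to \<open>[-1, 1]\<close>.\<close>
    let ?c = "2 * u - 1 + 1 / 2 ^ m"
    have "\<bar>?c\<bar> \<le> 1 - 1 / 2 ^ m" using u by (auto simp: abs_le_iff)
    then have "of_real ?c + z / 2 ^ m \<in> bernstein_ellipse \<rho>"
      by (rule scaled_bernstein_ellipse_subset[OF assms(1) that[unfolded R_def]])
    moreover have "\<Phi> z = ((of_real ?c + z / 2 ^ m) + 1) / 2"
      by (simp add: \<Phi>_def add_divide_distrib mult.commute)
    ultimately show ?thesis unfolding unit_bernstein_ellipse_def by blast
  qed
  have val: "F (\<Phi> (of_real (cos t))) = of_real (f (u + (cos t + 1) / 2 / 2 ^ m))" for t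
  proof -
    have c: "0 \<le> (cos t + 1) / 2" "(cos t + 1) / 2 \<le> 1"
      using cos_ge_minus_one[of t] cos_le_one[of t] by (simp_all del: cos_ge_minus_one cos_le_one)
    then have "(cos t + 1) / 2 / 2 ^ m \<le> 1 / 2 ^ m" by (intro divide_right_mono) auto
    moreover have "0 \<le> (cos t + 1) / 2 / 2 ^ m" using c by (intro divide_nonneg_pos) auto
    ultimately have "u + (cos t + 1) / 2 / 2 ^ m \<in> {0..1}" using u by auto
    then have "F (of_real (u + (cos t + 1) / 2 / 2 ^ m)) = of_real (f (u + (cos t + 1) / 2 / 2 ^ m))"
      using Ff by blast
    then show ?thesis by (simp add: \<Phi>_def)
  qed
  define \<theta> where "\<theta> = arccos (2 * v - 1)"
  have \<theta>: "(cos \<theta> + 1) / 2 = v" using v by (simp add: \<theta>_def)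
  have "interp_defect N \<theta> (\<lambda>t. F (\<Phi> (of_real (cos t)))) =
      of_real (f (u + v / 2 ^ m) -
       (\<Sum>\<alpha>\<le>N. f (u + cheb_node N \<alpha> / 2 ^ m) * poly (lagrange_basis N \<alpha>) v))"
    by (simp only: interp_defect_def val \<theta> cheb_node_def of_real_diff of_real_sum of_real_mult)
  then have "interp_residual m N f u v = norm (interp_defect N \<theta> (\<lambda>t. F (\<Phi> (of_real (cos t)))))"
    by (simp only: interp_residual_def norm_of_real)
  also have "\<dots> \<le> 4 * B / (R ^ N * (R - 1))"
  proof (rule chebyshev_interpolation_bound[where g = "\<lambda>z. F (\<Phi> z)", OF \<open>N \<ge> 1\<close> R _ _ \<open>B \<ge> 0\<close>])
    have "\<Phi> holomorphic_on bernstein_ellipse R"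
      unfolding \<Phi>_def by (intro holomorphic_intros) auto
    then show "(\<lambda>z. F (\<Phi> z)) holomorphic_on bernstein_ellipse R"
      using holomorphic_on_compose_gen[OF _ analytic_imp_holomorphic[OF F], of \<Phi>] \<Phi>
      by (auto simp: o_def image_subset_iff)
  qed (use \<Phi> B in auto)
  finally show ?thesis by (simp add: R_def)
qed

lemma finite_bits: "finite (bits K)"
  unfolding bits_def by (rule finite_lists_length_eq) simp

lemma tensor_norm_le:
  assumes "\<And>\<sigma>. \<sigma> \<in> bits K \<Longrightarrow> \<bar>S \<sigma>\<bar> \<le> e"
  shows "tensor_norm K S \<le> e"
proof -
  have "replicate K 0 \<in> bits K" by (auto simp: bits_def)
  then show ?thesis
    unfolding tensor_norm_def using assms finite_bits by (subst Max_le_iff) auto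
qed

lemma binary_fraction_bounds:
  assumes "\<sigma> \<in> bits K"
  shows "(\<Sum>k=1..K. (1 / 2) ^ k * real (\<sigma> ! (k - 1))) \<in> {0..1 - 1 / 2 ^ K}"
proof -
  have b: "real (\<sigma> ! (k - 1)) \<le> 1" if "k \<in> {1..K}" for k
  proof -
    have "\<sigma> ! (k - 1) \<in> set \<sigma>" using assms that by (intro nth_mem) (auto simp: bits_def)
    then show ?thesis using assms by (auto simp: bits_def)
  qed
  have "(\<Sum>k=1..K. (1 / 2) ^ k * real (\<sigma> ! (k - 1))) \<le> (\<Sum>k=1..K. (1 / 2 :: real) ^ k)"
    by (intro sum_mono mult_left_le b) auto
  also have "\<dots> = 1 - 1 / 2 ^ K"
    by (induction K) (simp_all add: field_simps)
  finally show ?thesis by (auto intro: sum_nonneg)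
qed

text \<open>The first \<open>m\<close> binary digits select the dyadic interval, the others the position in it.\<close>

lemma binary_fraction_split:
  assumes "m \<le> K" "length \<sigma> = K"
  shows "(\<Sum>k=1..K. (1 / 2) ^ k * real (\<sigma> ! (k - 1))) =
     (\<Sum>k=1..m. (1 / 2) ^ k * real (take m \<sigma> ! (k - 1))) +
     (\<Sum>k=1..K - m. (1 / 2) ^ k * real (drop m \<sigma> ! (k - 1))) / 2 ^ m"
proof -
  let ?h = "\<lambda>k. (1 / 2 :: real) ^ k * real (\<sigma> ! (k - 1))"
  have "{1..K} = {1..m} \<union> {1 + m..(K - m) + m}" using assms(1) by auto
  then have "sum ?h {1..K} = sum ?h {1..m} + sum ?h {1 + m..(K - m) + m}"
    by (simp only:) (rule sum.union_disjoint, auto)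
  also have "sum ?h {1 + m..(K - m) + m} = (\<Sum>k=1..K - m. ?h (k + m))"
    by (rule sum.shift_bounds_cl_nat_ivl)
  also have "\<dots> = (\<Sum>k=1..K - m. (1 / 2) ^ k * real (drop m \<sigma> ! (k - 1))) / 2 ^ m"
    unfolding sum_divide_distrib
    using assms by (intro sum.cong refl) (auto simp: power_add power_one_over field_simps add.commute)
  also have "sum ?h {1..m} = (\<Sum>k=1..m. (1 / 2) ^ k * real (take m \<sigma> ! (k - 1)))"
    by (intro sum.cong refl) auto
  finally show ?thesis .
qed

lemma eps_rank_le_interpolation:
  assumes "m < K"
    and res: "\<And>u v. u \<in> {0..1 - 1 / 2 ^ m} \<Longrightarrow> v \<in> {0..1} \<Longrightarrow> interp_residual m N f u v \<le> \<epsilon>"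
  shows "eps_rank K m \<epsilon> (quantized_tensor K f) \<le> Suc N"
  unfolding eps_rank_def
proof (rule Least_le, intro exI)
  let ?TL = "\<lambda>\<alpha> \<sigma>. f ((\<Sum>k=1..m. (1 / 2) ^ k * real (\<sigma> ! (k - 1))) + cheb_node N \<alpha> / 2 ^ m)"
  let ?TR = "\<lambda>\<alpha> \<sigma>. poly (lagrange_basis N \<alpha>) (\<Sum>k=1..K - m. (1 / 2) ^ k * real (\<sigma> ! (k - 1)))"
  show "tensor_norm K (\<lambda>\<sigma>. quantized_tensor K f \<sigma> -
      (\<Sum>\<alpha><Suc N. tensor_prod m (?TL \<alpha>) (?TR \<alpha>) \<sigma>)) \<le> \<epsilon>"
  proof (rule tensor_norm_le)
    fix \<sigma> assume \<sigma>: "\<sigma> \<in> bits K"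
    let ?u = "\<Sum>k=1..m. (1 / 2) ^ k * real (take m \<sigma> ! (k - 1))"
    let ?v = "\<Sum>k=1..K - m. (1 / 2) ^ k * real (drop m \<sigma> ! (k - 1))"
    have "take m \<sigma> \<in> bits m" "drop m \<sigma> \<in> bits (K - m)"
      using \<sigma> assms(1) set_take_subset[of m \<sigma>] set_drop_subset[of m \<sigma>] by (auto simp: bits_def)
    then have u: "?u \<in> {0..1 - 1 / 2 ^ m}" and "?v \<in> {0..1 - 1 / 2 ^ (K - m)}"
      using binary_fraction_bounds by blast+
    moreover have "{0..1 - 1 / 2 ^ (K - m)} \<subseteq> {0..1 :: real}" by auto
    ultimately have "interp_residual m N f ?u ?v \<le> \<epsilon>" using res by blast
    moreover have "quantized_tensor K f \<sigma> = f (?u + ?v / 2 ^ m)"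
      unfolding quantized_tensor_def
      by (subst binary_fraction_split[of m]) (use \<sigma> assms(1) in \<open>auto simp: bits_def\<close>)
    ultimately show "\<bar>quantized_tensor K f \<sigma> -
        (\<Sum>\<alpha><Suc N. tensor_prod m (?TL \<alpha>) (?TR \<alpha>) \<sigma>)\<bar> \<le> \<epsilon>"
      unfolding interp_residual_def tensor_prod_def lessThan_Suc_atMost by simp
  qed
qed

theorem proposition5:
  fixes \<rho> B :: real and f :: "real \<Rightarrow> real" and F :: "complex \<Rightarrow> complex" and m :: nat
  assumes "\<rho> > 1"
    and "F analytic_on unit_bernstein_ellipse \<rho>"
    and "\<forall>x\<in>{0..1}. F (complex_of_real x) = complex_of_real (f x)"
    and "B \<ge> 0"
    and "\<forall>z\<in>unit_bernstein_ellipse \<rho>. norm (F z) \<le> B"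
    and "m \<ge> 1"
  defines "\<rho>m \<equiv> rho_level \<rho> m"
  shows "(\<forall>N\<ge>1. interp_error m N f \<le> 4 * B * \<rho>m powi (- int N) / (\<rho>m - 1)) \<and>
    (\<forall>K>m. \<forall>\<epsilon>>0.
       int (eps_rank K m \<epsilon> (quantized_tensor K f)) \<le>
         1 + (if B = 0 then 1
              else max 1 \<lceil>log \<rho>m (1 / \<epsilon>) - log \<rho>m (\<rho>m - 1) + log \<rho>m (4 * B)\<rceil>))"
proof (intro conjI allI impI)
  have \<rho>m: "\<rho>m > 1" using rho_level_gt_1[OF assms(1)] by (simp add: \<rho>m_def)
  have res: "interp_residual m N f u v \<le> 4 * B / (\<rho>m ^ N * (\<rho>m - 1))"
    if "N \<ge> 1" "u \<in> {0..1 - 1 / 2 ^ m}" "v \<in> {0..1}" for N u v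
    unfolding \<rho>m_def by (rule interp_residual_le[OF assms(1-5) that])
  {
    fix N :: nat assume N: "N \<ge> 1"
    have "interp_error m N f \<le> 4 * B / (\<rho>m ^ N * (\<rho>m - 1))"
      unfolding interp_error_def by (rule cSUP_least) (use res[OF N] in auto)
    also have "\<dots> = 4 * B * \<rho>m powi (- int N) / (\<rho>m - 1)"
      by (simp add: power_int_minus field_simps)
    finally show "interp_error m N f \<le> 4 * B * \<rho>m powi (- int N) / (\<rho>m - 1)" .
  }
  fix K :: nat and \<epsilon> :: real
  assume K: "m < K" and \<epsilon>: "\<epsilon> > 0"
  define l where "l = log \<rho>m (1 / \<epsilon>) - log \<rho>m (\<rho>m - 1) + log \<rho>m (4 * B)"
  define N where "N = (if B = 0 then 1 else nat (max 1 \<lceil>l\<rceil>))"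
  have N: "N \<ge> 1" by (auto simp: N_def)
  have "4 * B / (\<rho>m ^ N * (\<rho>m - 1)) \<le> \<epsilon>"
  proof (cases "B = 0")
    case True
    then show ?thesis using \<epsilon> by simp
  next
    case False
    then have B: "B > 0" using assms(4) by simp
    have "l \<le> real N" using False by (simp add: N_def le_max_iff_disj) linarith
    moreover have "l = log \<rho>m (4 * B / (\<epsilon> * (\<rho>m - 1)))"
      using B \<epsilon> \<rho>m by (simp add: l_def log_divide log_mult)
    ultimately have "4 * B / (\<epsilon> * (\<rho>m - 1)) \<le> \<rho>m ^ N"
      using B \<epsilon> \<rho>m by (simp add: log_le_iff powr_realpow)
    then show ?thesis using \<epsilon> \<rho>m by (simp add: field_simps)
  qed
  then have "eps_rank K m \<epsilon> (quantized_tensor K f) \<le> Suc N"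
    using eps_rank_le_interpolation[OF K, of N f \<epsilon>] res[OF N] order.trans by blast
  then have "int (eps_rank K m \<epsilon> (quantized_tensor K f)) \<le> 1 + int N" by simp
  also have "\<dots> = 1 + (if B = 0 then 1 else max 1 \<lceil>l\<rceil>)" by (simp add: N_def)
  finally show "int (eps_rank K m \<epsilon> (quantized_tensor K f)) \<le> 1 + (if B = 0 then 1
      else max 1 \<lceil>log \<rho>m (1 / \<epsilon>) - log \<rho>m (\<rho>m - 1) + log \<rho>m (4 * B)\<rceil>)"
    by (simp only: l_def)
qed

end
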